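(* Let $(X,d)$ be a metric space. Assume that there exists a continuous semiflow $\phi: X\times [0,\infty)\to X$ satisfying the following property: for every $\varepsilon>0$ there exists $\delta>0$ such that for every pair of points $x,y$ in $X$ and every $s\in H^+$ such that $d(\phi_t(x),\phi_{s(t)}(y))<\delta$ for all $t\in[0,\infty)$, there exists $t_0\in[0,\varepsilon)$ such that $y=\phi_{t_0}(x)$. Then the following properties hold: (i) For every $t\in[0,\infty)$, the map $\phi_t$ is the identity map on $X$. (ii) The space $X$ is uniformly discrete; namely, there exists $\rho>0$ such that $d(x,y)\geq\rho$ for every pair of points $x,y$ in $X$ with $x\neq y$. In particular, if $X$ is compact then it is a finite set.
   Context: A continuous semiflow on a metric space $X$ is a continuous function $\phi:X\times[0,\infty)\to X$ such that $\phi(x,0)=x$ for all $x\in X$ and $\phi(x,t+s)=\phi(\phi(x,t),s)$ for all $x\in X$ and all $t,s\in[0,\infty)$. Write $\phi_t(x)=\phi(x,t)$. $H^+$ denotes the set of all functions $s:[0,\infty)\to[0,\infty)$ that are continuous, surjective, strictly increasing and satisfy $s(0)=0$. *)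

theory Defs
  imports "HOL-Analysis.Analysis"
begin

(* Time is the half-line {0..} of the reals.  A semiflow is a function on pairs whose values
   outside X \<times> {0..} are irrelevant; continuous_map also makes it map X \<times> {0..} into X. *)
definition continuous_semiflow :: "'a set \<Rightarrow> ('a \<Rightarrow> 'a \<Rightarrow> real) \<Rightarrow> ('a \<times> real \<Rightarrow> 'a) \<Rightarrow> bool" where
  "continuous_semiflow X d \<phi> \<longleftrightarrow>
     continuous_map (prod_topology (Metric_space.mtopology X d) (top_of_set {0..}))
       (Metric_space.mtopology X d) \<phi> \<and>
     (\<forall>x\<in>X. \<phi> (x, 0) = x) \<and>
     (\<forall>x\<in>X. \<forall>t\<in>{0..}. \<forall>s\<in>{0..}. \<phi> (x, t + s) = \<phi> (\<phi> (x, t), s))"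

definition H_plus :: "(real \<Rightarrow> real) set" where
  "H_plus = {s. continuous_on {0..} s \<and> s ` {0..} = {0..} \<and> strict_mono_on {0..} s \<and> s 0 = 0}"

end

theory Submission
  imports Defs
begin

text \<open>
  Compare the orbit of \<open>\<phi>\<^sub>\<tau>(x)\<close>, for small \<open>\<tau> > 0\<close>, with the orbit of \<open>x\<close> run at double speed until
  it has caught up at time \<open>\<tau>\<close>. The two stay close, so \<open>x\<close> lies forward of \<open>\<phi>\<^sub>\<tau>(x)\<close>
  and is therefore periodic with arbitrarily small positive periods, hence fixed by continuity.
  Once the flow is trivial, the hypothesis with \<open>s = id\<close> says that points at distance less than
  \<open>\<delta>\<close> coincide.
\<close>

text \<open>This is the clock for the orbit of \<open>x\<close>: double speed up to time
  \<open>\<tau>\<close>, where the two branches of the minimum meet, then unit speed with a constant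
  lead of \<open>\<tau>\<close>.\<close>

lemma catch_up_in_H_plus:
  assumes "\<tau> \<ge> 0"
  shows "(\<lambda>t. min (2 * t) (t + \<tau>)) \<in> H_plus"
proof -
  have "u \<in> (\<lambda>t. min (2 * t) (t + \<tau>)) ` {0..}" if "u \<ge> 0" for u
    \<comment> \<open>The inverse of a minimum of two increasing bijections of the line is the
      maximum of their inverses.\<close>
    using that assms by (intro image_eqI[where x = "max (u / 2) (u - \<tau>)"]) (auto simp: max_def min_def field_simps)
  then show ?thesis
    using assms by (auto simp: H_plus_def strict_mono_on_def intro!: continuous_intros)
qed

lemma id_in_H_plus: "(\<lambda>t. t) \<in> H_plus"
  by (auto simp: H_plus_def strict_mono_on_def)

lemma semiflow_in:
  assumes "Metric_space X d" "continuous_semiflow X d \<phi>" "x \<in> X" "t \<ge> 0"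
  shows "\<phi> (x, t) \<in> X"
  using assms unfolding continuous_semiflow_def continuous_map_def
  by (auto simp: Metric_space.topspace_mtopology)

lemma semiflow_near_start:
  assumes "Metric_space X d" "continuous_semiflow X d \<phi>" "x \<in> X" "\<eta> > 0"
  obtains \<sigma> where "\<sigma> > 0" "\<And>t. 0 \<le> t \<Longrightarrow> t < \<sigma> \<Longrightarrow> d x (\<phi> (x, t)) < \<eta>"
proof -
  interpret Metric_space X d by fact
  have "continuous_map (top_of_set {0..}) (prod_topology mtopology (top_of_set {0..})) (\<lambda>t. (x, t))"
    using \<open>x \<in> X\<close> by (simp add: continuous_map_pairedI)
  then have "continuous_map (top_of_set {0..}) mtopology (\<phi> \<circ> (\<lambda>t. (x, t)))"
    using assms(2) unfolding continuous_semiflow_def by (blast intro: continuous_map_compose)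
  then have "openin (top_of_set {0::real..}) {t \<in> {0..}. \<phi> (x, t) \<in> mball x \<eta>}"
    using openin_continuous_map_preimage[OF _ openin_mball] by fastforce
  moreover have "0 \<in> {t \<in> {0..}. \<phi> (x, t) \<in> mball x \<eta>}"
    using assms by (simp add: continuous_semiflow_def)
  ultimately obtain \<sigma> where "\<sigma> > 0"
    and \<sigma>: "ball 0 \<sigma> \<inter> {0..} \<subseteq> {t \<in> {0..}. \<phi> (x, t) \<in> mball x \<eta>}"
    unfolding openin_contains_ball by blast
  have "d x (\<phi> (x, t)) < \<eta>" if "0 \<le> t" "t < \<sigma>" for t
    using subsetD[OF \<sigma>, of t] that by simp
  with \<open>\<sigma> > 0\<close> show ?thesis by (rule that)
qed

lemma semiflow_add_period_multiple:
  assumes "continuous_semiflow X d \<phi>" "x \<in> X" "p \<ge> 0" "\<phi> (x, p) = x" "r \<ge> 0"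
  shows "\<phi> (x, real n * p + r) = \<phi> (x, r)"
proof (induction n)
  case (Suc n)
  have "\<phi> (x, p + (real n * p + r)) = \<phi> (\<phi> (x, p), real n * p + r)"
    using assms by (simp add: continuous_semiflow_def)
  with Suc assms(4) show ?case
    by (simp add: algebra_simps)
qed simp

text \<open>Removing whole periods from \<open>t\<close> leaves a remainder smaller than the period.
  With a small enough period, continuity at time 0 keeps the point within any prescribed distance of
  \<open>x\<close>.\<close>

lemma fixed_if_small_periods:
  assumes "Metric_space X d" "continuous_semiflow X d \<phi>" "x \<in> X" "t \<ge> 0"
    and period: "\<And>\<epsilon>. \<epsilon> > 0 \<Longrightarrow> \<exists>p. 0 < p \<and> p < \<epsilon> \<and> \<phi> (x, p) = x"
  shows "\<phi> (x, t) = x"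
proof -
  interpret Metric_space X d by fact
  have "d x (\<phi> (x, t)) < \<eta>" if "\<eta> > 0" for \<eta>
  proof -
    obtain \<sigma> where "\<sigma> > 0" and \<sigma>: "\<And>t. 0 \<le> t \<Longrightarrow> t < \<sigma> \<Longrightarrow> d x (\<phi> (x, t)) < \<eta>"
      using semiflow_near_start[OF assms(1-3) \<open>\<eta> > 0\<close>] by blast
    obtain p where p: "0 < p" "p < \<sigma>" "\<phi> (x, p) = x"
      using period[OF \<open>\<sigma> > 0\<close>] by blast
    \<comment> \<open>The number of whole periods in \<open>t\<close>, so that
      \<open>t - real n * p\<close> lies in [0, p) and hence below \<open>\<sigma>\<close>.\<close>
    define n where "n = nat \<lfloor>t / p\<rfloor>"
    have "real n = of_int \<lfloor>t / p\<rfloor>"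
      using \<open>t \<ge> 0\<close> p by (simp add: n_def)
    then have n: "real n \<le> t / p" "t / p < real n + 1"
      by linarith+
    then have "0 \<le> t - real n * p" "t - real n * p < p"
      using p by (simp_all add: field_simps)
    then show ?thesis
      using semiflow_add_period_multiple[OF assms(2,3) _ p(3), of "t - real n * p" n] p
        \<sigma>[of "t - real n * p"] by simp
  qed
  then have "d x (\<phi> (x, t)) = 0"
    by (metis less_irrefl nonneg order_le_less)
  then show ?thesis
    using semiflow_in[OF assms(1-4)] \<open>x \<in> X\<close> by simp
qed

lemma small_period:
  assumes "Metric_space X d" "continuous_semiflow X d \<phi>" "x \<in> X" "\<epsilon> > 0" "\<delta> > 0"
    and expansive: "\<forall>x\<in>X. \<forall>y\<in>X. \<forall>s\<in>H_plus.
           (\<forall>t\<in>{0..}. d (\<phi> (x, t)) (\<phi> (y, s t)) < \<delta>) \<longrightarrow>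
           (\<exists>t\<^sub>0\<in>{0..<\<epsilon>}. y = \<phi> (x, t\<^sub>0))"
  shows "\<exists>p. 0 < p \<and> p < 2 * \<epsilon> \<and> \<phi> (x, p) = x"
proof -
  interpret Metric_space X d by fact
  obtain \<sigma> where "\<sigma> > 0" and \<sigma>: "\<And>t. 0 \<le> t \<Longrightarrow> t < \<sigma> \<Longrightarrow> d x (\<phi> (x, t)) < \<delta> / 2"
    using semiflow_near_start[OF assms(1-3), of "\<delta> / 2"] \<open>\<delta> > 0\<close> by auto
  \<comment> \<open>For \<open>t < \<tau>\<close> the times \<open>\<tau> + t\<close> and
    \<open>2 * t\<close> are both below \<open>2 * \<tau>\<close>, so
    \<open>2 * \<tau> < \<sigma>\<close> keeps both points near \<open>x\<close>;
    \<open>\<tau> < \<epsilon>\<close> serves the final bound \<open>2 * \<epsilon>\<close>.\<close>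
  define \<tau> where "\<tau> = min (\<sigma> / 2) \<epsilon> / 2"
  have \<tau>: "0 < \<tau>" "2 * \<tau> < \<sigma>" "\<tau> < \<epsilon>"
    using \<open>\<sigma> > 0\<close> \<open>\<epsilon> > 0\<close> by (auto simp: \<tau>_def)
  have add: "\<phi> (\<phi> (x, \<tau>), t) = \<phi> (x, \<tau> + t)" if "t \<ge> 0" for t
    using assms(2,3) \<tau> that by (simp add: continuous_semiflow_def)
  have "d (\<phi> (\<phi> (x, \<tau>), t)) (\<phi> (x, min (2 * t) (t + \<tau>))) < \<delta>" if "t \<ge> 0" for t
  proof (cases "t < \<tau>")
    case True
    have "d (\<phi> (x, \<tau> + t)) (\<phi> (x, 2 * t)) \<le> d x (\<phi> (x, \<tau> + t)) + d x (\<phi> (x, 2 * t))"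
      using triangle[of "\<phi> (x, \<tau> + t)" x "\<phi> (x, 2 * t)"] semiflow_in[OF assms(1-3)] \<open>x \<in> X\<close> that \<tau>
      by (simp add: commute)
    moreover have "d x (\<phi> (x, \<tau> + t)) < \<delta> / 2" "d x (\<phi> (x, 2 * t)) < \<delta> / 2"
      using True that \<tau> by (intro \<sigma>; linarith)+
    ultimately show ?thesis
      using True that by (simp add: add min_def)
  next
    \<comment> \<open>After catching up, both points are
      \<open>\<phi> (x, \<tau> + t)\<close>.\<close>
    case False
    then show ?thesis
      using that \<tau> \<open>\<delta> > 0\<close> semiflow_in[OF assms(1-3)] by (simp add: add min_def add.commute)
  qed
  \<comment> \<open>The order of the two points matters: with \<open>\<phi> (x, \<tau>)\<close>
    first, \<open>x\<close> is reached from it, and the return time \<open>\<tau> + t\<close> is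
    positive even if \<open>t = 0\<close>. The opposite order would only yield
    \<open>\<phi> (x, \<tau>) = \<phi> (x, t)\<close> for some \<open>t\<close>, which holds
    trivially.\<close>
  then obtain t where "0 \<le> t" "t < \<epsilon>" "x = \<phi> (\<phi> (x, \<tau>), t)"
    using expansive[rule_format, OF semiflow_in[OF assms(1-3)] \<open>x \<in> X\<close> catch_up_in_H_plus, of \<tau> \<tau>] \<tau>
    by auto
  then have "0 < \<tau> + t \<and> \<tau> + t < 2 * \<epsilon> \<and> \<phi> (x, \<tau> + t) = x"
    using \<tau> by (simp add: add)
  then show ?thesis ..
qed

lemma (in Metric_space) uniformly_discrete_compact_imp_finite:
  assumes "\<rho> > 0" "\<forall>x\<in>M. \<forall>y\<in>M. x \<noteq> y \<longrightarrow> \<rho> \<le> d x y" "compact_space mtopology"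
  shows "finite M"
proof -
  have "mtotally_bounded M"
    using assms(3) compactin_imp_mtotally_bounded by (simp add: compact_space_def)
  then obtain K where "finite K" "K \<subseteq> M" and cover: "M \<subseteq> (\<Union>x\<in>K. mball x \<rho>)"
    using \<open>\<rho> > 0\<close> unfolding mtotally_bounded_def by meson
  \<comment> \<open>By the separation of points, an open ball of radius \<open>\<rho>\<close>
    contains only its centre.\<close>
  have "M \<subseteq> K"
    using cover assms(2) by fastforce
  then show ?thesis
    using \<open>finite K\<close> finite_subset by blast
qed

theorem theorem1p1:
  fixes X :: "'a set" and d :: "'a \<Rightarrow> 'a \<Rightarrow> real" and \<phi> :: "'a \<times> real \<Rightarrow> 'a"
  assumes "Metric_space X d"
    and "continuous_semiflow X d \<phi>"
    and "\<forall>\<epsilon>>0. \<exists>\<delta>>0. \<forall>x\<in>X. \<forall>y\<in>X. \<forall>s\<in>H_plus.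
           (\<forall>t\<in>{0..}. d (\<phi> (x, t)) (\<phi> (y, s t)) < \<delta>) \<longrightarrow>
           (\<exists>t\<^sub>0\<in>{0..<\<epsilon>}. y = \<phi> (x, t\<^sub>0))"
  shows "(\<forall>t\<in>{0..}. \<forall>x\<in>X. \<phi> (x, t) = x) \<and>
         (\<exists>\<rho>>0. \<forall>x\<in>X. \<forall>y\<in>X. x \<noteq> y \<longrightarrow> \<rho> \<le> d x y) \<and>
         (compact_space (Metric_space.mtopology X d) \<longrightarrow> finite X)"
proof -
  interpret Metric_space X d by fact
  have fixed: "\<phi> (x, t) = x" if "x \<in> X" "t \<ge> 0" for x t
  proof (rule fixed_if_small_periods[OF assms(1,2) that])
    fix \<epsilon> :: real assume "\<epsilon> > 0"
    \<comment> \<open>Halving compensates for the factor 2 in \<open>small_period\<close>.\<close>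
    then have half: "\<epsilon> / 2 > 0" by simp
    obtain \<delta> where "\<delta> > 0" and "\<forall>x\<in>X. \<forall>y\<in>X. \<forall>s\<in>H_plus.
           (\<forall>t\<in>{0..}. d (\<phi> (x, t)) (\<phi> (y, s t)) < \<delta>) \<longrightarrow>
           (\<exists>t\<^sub>0\<in>{0..<\<epsilon> / 2}. y = \<phi> (x, t\<^sub>0))"
      using assms(3) half by blast
    from small_period[OF assms(1,2) \<open>x \<in> X\<close> half this]
    show "\<exists>p. 0 < p \<and> p < \<epsilon> \<and> \<phi> (x, p) = x" by simp
  qed
  \<comment> \<open>The bound 1 is an arbitrary choice: all orbits are now constant, so the
    conclusion reads \<open>y = x\<close> whatever the time.\<close>
  obtain \<delta> where "\<delta> > 0" and \<delta>: "\<forall>x\<in>X. \<forall>y\<in>X. \<forall>s\<in>H_plus.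
           (\<forall>t\<in>{0..}. d (\<phi> (x, t)) (\<phi> (y, s t)) < \<delta>) \<longrightarrow>
           (\<exists>t\<^sub>0\<in>{0..<1}. y = \<phi> (x, t\<^sub>0))"
    using assms(3) zero_less_one by blast
  \<comment> \<open>Constant orbits stay at distance \<open>d x y\<close> for all time, so the
    identity clock meets the closeness condition.\<close>
  have "x = y" if "x \<in> X" "y \<in> X" "d x y < \<delta>" for x y
    using \<delta>[rule_format, OF that(1,2) id_in_H_plus] that fixed by auto
  then have "\<forall>x\<in>X. \<forall>y\<in>X. x \<noteq> y \<longrightarrow> \<delta> \<le> d x y"
    by (meson not_le)
  with fixed \<open>\<delta> > 0\<close> uniformly_discrete_compact_imp_finite show ?thesis
    by (auto intro!: exI[of _ \<delta>])
qed

end
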